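(* Let $\mathcal{T},\mathcal{A}\in\Pi_3$. The partial integral equation (PIE) $\mathcal{T}\dot{\mathbf{x}}=\mathcal{A}\mathbf{x}$ is: (1) Lyapunov PIE to PDE stable if there exist $\mathcal{Q}\in\Pi_3$ and $\epsilon>0$ such that $\mathcal{Q}\mathcal{T}=(\mathcal{Q}\mathcal{T})^*\ge\epsilon\mathcal{T}^*\mathcal{T}$ and $\mathcal{Q}\mathcal{A}+\mathcal{A}^*\mathcal{Q}^*\le0$; (2) Lyapunov PIE stable if there exist $\mathcal{Q}\in\Pi_3$ and $\epsilon>0$ such that $\mathcal{Q}\mathcal{T}=(\mathcal{Q}\mathcal{T})^*\ge\epsilon I$ and $\mathcal{Q}\mathcal{A}+\mathcal{A}^*\mathcal{Q}^*\le0$; (3) Lyapunov PDE stable if there exist $\mathcal{P}=\mathcal{P}^*\in\Pi_3$ and $\epsilon>0$ such that $\mathcal{P}\ge\epsilon I$ and $\mathcal{T}^*\mathcal{P}\mathcal{A}+\mathcal{A}^*\mathcal{P}\mathcal{T}\le0$; (4) Lyapunov PDE to PIE stable if there exist $\mathcal{Q}\in\Pi_3$ and $\epsilon,C>0$ such that $\mathcal{Q}\mathcal{T}=(\mathcal{Q}\mathcal{T})^*\ge\epsilon I$, $\mathcal{Q}\mathcal{T}\le C\mathcal{T}^*\mathcal{T}$ and $\mathcal{Q}\mathcal{A}+\mathcal{A}^*\mathcal{Q}^*\le0$.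
   Context: $L_2$ denotes the real Hilbert space $L_2([0,1];\mathbb{R}^m)$ with inner product $\langle\cdot,\cdot\rangle$ and norm $\|\cdot\|$. A partial integral (PI) operator is a bounded linear operator $\mathcal{P}:L_2\to L_2$ of the form $(\mathcal{P}\mathbf{x})(s)=R_0(s)\mathbf{x}(s)+\int_0^s R_1(s,\theta)\mathbf{x}(\theta)\,d\theta+\int_s^1R_2(s,\theta)\mathbf{x}(\theta)\,d\theta$ with (matrix-valued) $R_0\in L_\infty$ and $R_1,R_2\in L_2$; $\Pi_3$ is the set of all such operators. Adjoints $(\cdot)^*$ are with respect to the $L_2$ inner product, $I$ is the identity, and an operator inequality $\mathcal{M}\ge\mathcal{N}$ means $\langle\mathbf{x},\mathcal{M}\mathbf{x}\rangle\ge\langle\mathbf{x},\mathcal{N}\mathbf{x}\rangle$ for all $\mathbf{x}\in L_2$. A solution of $\mathcal{T}\dot{\mathbf{x}}=\mathcal{A}\mathbf{x}$ is a differentiable function $\mathbf{x}:[0,\infty)\to L_2$ with $\mathcal{T}\dot{\mathbf{x}}(t)=\mathcal{A}\mathbf{x}(t)$ for all $t\ge 0$. (When the PIE comes from a classically well-posed PDE, $\mathcal{T}\mathbf{x}(t)$ is the PDE state; this only motivates the terminology.) The PIE is called: - Lyapunov PIE to PDE stable if there is $C>0$ such that every solution satisfies $\|\mathcal{T}\mathbf{x}(t)\|\le C\|\mathbf{x}(0)\|$ for all $t\ge0$; - Lyapunov PIE stable if there is $C>0$ such that every solution satisfies $\|\mathbf{x}(t)\|\le C\|\mathbf{x}(0)\|$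 for all $t\ge0$; - Lyapunov PDE stable if there is $C>0$ such that every solution satisfies $\|\mathcal{T}\mathbf{x}(t)\|\le C\|\mathcal{T}\mathbf{x}(0)\|$ for all $t\ge0$; - Lyapunov PDE to PIE stable if there is $C>0$ such that every solution satisfies $\|\mathbf{x}(t)\|\le C\|\mathcal{T}\mathbf{x}(0)\|$ for all $t\ge0$. *)

theory Defs
  imports "HOL-Analysis.Analysis"
begin

section \<open>The space \<open>L\<^sub>2([0,1]; \<real>\<^sup>m)\<close>\<close>

abbreviation unit_leb :: "real measure"
  where "unit_leb \<equiv> lebesgue_on {0..1}"

definition square_integrable :: "'a measure \<Rightarrow> ('a \<Rightarrow> 'b::euclidean_space) \<Rightarrow> bool"
  where "square_integrable M f \<longleftrightarrow> f \<in> borel_measurable M \<and> integrable M (\<lambda>s. (norm (f s))\<^sup>2)"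

definition l2_rel :: "(real \<Rightarrow> real ^ 'm) \<Rightarrow> (real \<Rightarrow> real ^ 'm) \<Rightarrow> bool"
  where "l2_rel f g \<longleftrightarrow> square_integrable unit_leb f \<and> square_integrable unit_leb g \<and>
           (AE s in unit_leb. f s = g s)"

lemma square_integrable_measurable:
  "square_integrable M f \<Longrightarrow> f \<in> borel_measurable M"
  by (simp add: square_integrable_def)

lemma square_integrable_zero: "square_integrable M (\<lambda>_. 0)"
  by (simp add: square_integrable_def)

lemma square_integrable_scaleR:
  "square_integrable M f \<Longrightarrow> square_integrable M (\<lambda>s. c *\<^sub>R f s)"
  by (auto simp: square_integrable_def power_mult_distrib)

lemma square_integrable_add:
  assumes "square_integrable M f" "square_integrable M g"
  shows "square_integrable M (\<lambda>s. f s + g s)"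
proof -
  have [measurable]: "f \<in> borel_measurable M" "g \<in> borel_measurable M"
    using assms by (auto simp: square_integrable_def)
  have i: "integrable M (\<lambda>s. 2 * (norm (f s))\<^sup>2 + 2 * (norm (g s))\<^sup>2)"
    using assms by (auto simp: square_integrable_def)
  have b: "(norm (u + v))\<^sup>2 \<le> 2 * (norm u)\<^sup>2 + 2 * (norm v)\<^sup>2" for u v :: 'b
  proof -
    have "(norm (u + v))\<^sup>2 \<le> (norm u + norm v)\<^sup>2"
      by (simp add: norm_triangle_ineq power_mono)
    also have "\<dots> \<le> 2 * (norm u)\<^sup>2 + 2 * (norm v)\<^sup>2"
      using sum_squares_bound[of "norm u" "norm v"] by (simp add: power2_sum)
    finally show ?thesis .
  qed
  have "integrable M (\<lambda>s. (norm (f s + g s))\<^sup>2)"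
    by (rule Bochner_Integration.integrable_bound[OF i]) (use b in auto)
  then show ?thesis by (simp add: square_integrable_def)
qed

lemma square_integrable_minus:
  "square_integrable M f \<Longrightarrow> square_integrable M (\<lambda>s. - f s)"
  by (auto simp: square_integrable_def)

lemma square_integrable_diff:
  "square_integrable M f \<Longrightarrow> square_integrable M g \<Longrightarrow> square_integrable M (\<lambda>s. f s - g s)"
  using square_integrable_add[OF _ square_integrable_minus, of M f g] by simp

lemma norm_mult_le_squares: "norm u * norm v \<le> (norm u)\<^sup>2 + (norm v)\<^sup>2"
  for u :: "'a::real_normed_vector" and v :: "'b::real_normed_vector"
  using sum_squares_bound[of "norm u" "norm v"] zero_le_power2[of "norm u"] zero_le_power2[of "norm v"]
  by linarith

lemma integrable_norm_mult:
  assumes "square_integrable M f" "square_integrable M g"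
  shows "integrable M (\<lambda>s. norm (f s) * norm (g s))"
proof -
  have [measurable]: "f \<in> borel_measurable M" "g \<in> borel_measurable M"
    using assms by (auto simp: square_integrable_def)
  have i: "integrable M (\<lambda>s. (norm (f s))\<^sup>2 + (norm (g s))\<^sup>2)"
    using assms by (auto simp: square_integrable_def)
  show ?thesis
    by (rule Bochner_Integration.integrable_bound[OF i]) (use norm_mult_le_squares in auto)
qed

lemma integrable_inner:
  assumes "square_integrable M f" "square_integrable M g"
  shows "integrable M (\<lambda>s. f s \<bullet> g s)"
proof -
  have [measurable]: "f \<in> borel_measurable M" "g \<in> borel_measurable M"
    using assms by (auto simp: square_integrable_def)
  show ?thesis
    by (rule Bochner_Integration.integrable_bound[OF integrable_norm_mult[OF assms]])
       (use Cauchy_Schwarz_ineq2 in auto)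
qed

quotient_type (overloaded) 'm L2 = "real \<Rightarrow> real ^ 'm::finite" / partial: l2_rel
proof (rule part_equivpI)
  show "\<exists>f. l2_rel f f"
    by (rule exI[of _ "\<lambda>_. 0"]) (simp add: l2_rel_def square_integrable_zero)
  show "symp l2_rel"
    by (auto simp: symp_def l2_rel_def)
  show "transp l2_rel"
    by (auto simp: transp_def l2_rel_def)
qed

instantiation L2 :: (finite) real_inner
begin

lift_definition zero_L2 :: "'a L2" is "\<lambda>_. 0"
  by (simp add: l2_rel_def square_integrable_zero)

lift_definition plus_L2 :: "'a L2 \<Rightarrow> 'a L2 \<Rightarrow> 'a L2" is "\<lambda>f g s. f s + g s"
  by (auto simp: l2_rel_def square_integrable_add)

lift_definition minus_L2 :: "'a L2 \<Rightarrow> 'a L2 \<Rightarrow> 'a L2" is "\<lambda>f g s. f s - g s"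
  by (auto simp: l2_rel_def square_integrable_diff)

lift_definition uminus_L2 :: "'a L2 \<Rightarrow> 'a L2" is "\<lambda>f s. - f s"
  by (auto simp: l2_rel_def square_integrable_minus)

lift_definition scaleR_L2 :: "real \<Rightarrow> 'a L2 \<Rightarrow> 'a L2" is "\<lambda>c f s. c *\<^sub>R f s"
  by (auto simp: l2_rel_def square_integrable_scaleR)

lift_definition inner_L2 :: "'a L2 \<Rightarrow> 'a L2 \<Rightarrow> real" is "\<lambda>f g. LINT s|unit_leb. f s \<bullet> g s"
proof -
  fix f f' g g' :: "real \<Rightarrow> real ^ 'a"
  assume *: "l2_rel f f'" "l2_rel g g'"
  then have [measurable]: "f \<in> borel_measurable unit_leb" "g \<in> borel_measurable unit_leb"
     "f' \<in> borel_measurable unit_leb" "g' \<in> borel_measurable unit_leb"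
    by (auto simp: l2_rel_def square_integrable_def)
  have "AE s in unit_leb. f s = f' s" "AE s in unit_leb. g s = g' s"
    using * by (auto simp: l2_rel_def)
  then have "AE s in unit_leb. f s \<bullet> g s = f' s \<bullet> g' s"
    by eventually_elim simp
  then show "(LINT s|unit_leb. f s \<bullet> g s) = (LINT s|unit_leb. f' s \<bullet> g' s)"
    by (intro integral_cong_AE) simp_all
qed

definition norm_L2 :: "'a L2 \<Rightarrow> real"
  where "norm_L2 x = sqrt (x \<bullet> x)"

definition sgn_L2 :: "'a L2 \<Rightarrow> 'a L2"
  where "sgn_L2 x = inverse (norm x) *\<^sub>R x"

definition dist_L2 :: "'a L2 \<Rightarrow> 'a L2 \<Rightarrow> real"
  where "dist_L2 x y = norm (x - y)"

definition uniformity_L2 :: "('a L2 \<times> 'a L2) filter"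
  where "uniformity_L2 = (INF e\<in>{0<..}. principal {(x, y). dist x y < e})"

definition open_L2 :: "'a L2 set \<Rightarrow> bool"
  where "open_L2 U \<longleftrightarrow> (\<forall>x\<in>U. \<forall>\<^sub>F (x', y) in uniformity. x' = x \<longrightarrow> y \<in> U)"

instance
proof
  fix x y z :: "'a L2" and a b :: real and U :: "'a L2 set"
  show "x + y + z = x + (y + z)"
    by transfer (auto simp: l2_rel_def add.assoc square_integrable_add)
  show "x + y = y + x"
    by transfer (auto simp: l2_rel_def add.commute square_integrable_add)
  show "0 + x = x"
    by transfer (auto simp: l2_rel_def)
  show "- x + x = 0"
    by transfer (auto simp: l2_rel_def square_integrable_zero)
  show "x - y = x + - y"
    by transfer (auto simp: l2_rel_def square_integrable_diff)
  show "a *\<^sub>R (x + y) = a *\<^sub>R x + a *\<^sub>R y"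
    by transfer (auto simp: l2_rel_def scaleR_add_right square_integrable_add square_integrable_scaleR)
  show "(a + b) *\<^sub>R x = a *\<^sub>R x + b *\<^sub>R x"
    by transfer (auto simp: l2_rel_def scaleR_add_left square_integrable_add square_integrable_scaleR)
  show "a *\<^sub>R b *\<^sub>R x = (a * b) *\<^sub>R x"
    by transfer (auto simp: l2_rel_def square_integrable_scaleR)
  show "1 *\<^sub>R x = x"
    by transfer (auto simp: l2_rel_def)
  show "sgn x = inverse (norm x) *\<^sub>R x" "dist x y = norm (x - y)" "norm x = sqrt (x \<bullet> x)"
    "uniformity = (INF e\<in>{0<..}. principal {(x, y::'a L2). dist x y < e})"
    "open U \<longleftrightarrow> (\<forall>x\<in>U. \<forall>\<^sub>F (x', y) in uniformity. x' = x \<longrightarrow> y \<in> U)"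
    by (simp_all add: sgn_L2_def dist_L2_def norm_L2_def uniformity_L2_def open_L2_def)
  show "x \<bullet> y = y \<bullet> x"
    by transfer (simp add: inner_commute)
  show "(x + y) \<bullet> z = x \<bullet> z + y \<bullet> z"
    by transfer (auto simp: l2_rel_def inner_add_left integrable_inner)
  show "(a *\<^sub>R x) \<bullet> y = a * (x \<bullet> y)"
    by transfer simp
  show "0 \<le> x \<bullet> x"
    by transfer (auto intro!: integral_nonneg_AE)
  show "x \<bullet> x = 0 \<longleftrightarrow> x = 0"
  proof transfer
    fix f :: "real \<Rightarrow> real ^ 'a"
    assume "l2_rel f f"
    then have f: "square_integrable unit_leb f" by (simp add: l2_rel_def)
    have "(LINT s|unit_leb. f s \<bullet> f s) = 0 \<longleftrightarrow> (AE s in unit_leb. f s \<bullet> f s = 0)"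
      by (rule integral_nonneg_eq_0_iff_AE[OF integrable_inner[OF f f]]) simp
    then show "(LINT s|unit_leb. f s \<bullet> f s) = 0 \<longleftrightarrow> l2_rel f (\<lambda>_. 0)"
      by (simp add: l2_rel_def f square_integrable_zero)
  qed
qed

end

section \<open>Partial integral operators\<close>

text \<open>Boundedness is part of the type of \<open>P\<close>; \<open>rep_L2\<close> picks a representative of a class,
  and the right-hand side does not depend on which one.\<close>

definition has_PI_form :: "('m::finite L2 \<Rightarrow>\<^sub>L 'm L2) \<Rightarrow> (real \<Rightarrow> real ^ 'm ^ 'm) \<Rightarrow>
    (real \<times> real \<Rightarrow> real ^ 'm ^ 'm) \<Rightarrow> (real \<times> real \<Rightarrow> real ^ 'm ^ 'm) \<Rightarrow> bool"
  where "has_PI_form P R0 R1 R2 \<longleftrightarrow>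
    (\<forall>x. AE s in unit_leb. rep_L2 (P x) s =
        R0 s *v rep_L2 x s
        + (LINT \<theta>|lebesgue_on {0..s}. R1 (s, \<theta>) *v rep_L2 x \<theta>)
        + (LINT \<theta>|lebesgue_on {s..1}. R2 (s, \<theta>) *v rep_L2 x \<theta>))"

definition essentially_bounded :: "'a measure \<Rightarrow> ('a \<Rightarrow> 'b::euclidean_space) \<Rightarrow> bool"
  where "essentially_bounded M f \<longleftrightarrow> f \<in> borel_measurable M \<and> (\<exists>B. AE s in M. norm (f s) \<le> B)"

definition PI_ops :: "('m::finite L2 \<Rightarrow>\<^sub>L 'm L2) set"  (\<open>\<Pi>\<^sub>3\<close>)
  where "\<Pi>\<^sub>3 = {P. \<exists>R0 R1 R2. essentially_bounded unit_leb R0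
      \<and> square_integrable (unit_leb \<Otimes>\<^sub>M unit_leb) R1
      \<and> square_integrable (unit_leb \<Otimes>\<^sub>M unit_leb) R2
      \<and> has_PI_form P R0 R1 R2}"

text \<open>\<open>adjoint\<close> picks some map satisfying the defining identity of the adjoint. It is
  meaningful only where such a map exists, which \<open>PI_adjoint_exists\<close> and \<open>inner_adj\<close> below
  establish for partial integral operators.\<close>

definition adj :: "('m::finite L2 \<Rightarrow>\<^sub>L 'm L2) \<Rightarrow> ('m L2 \<Rightarrow>\<^sub>L 'm L2)"
  where "adj P = Blinfun (adjoint (blinfun_apply P))"

definition op_le :: "('m::finite L2 \<Rightarrow>\<^sub>L 'm L2) \<Rightarrow> ('m L2 \<Rightarrow>\<^sub>L 'm L2) \<Rightarrow> bool"
    (infix \<open>\<preceq>\<close> 50)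
  where "N \<preceq> M \<longleftrightarrow> (\<forall>x. x \<bullet> N x \<le> x \<bullet> M x)"

subsection \<open>Partial integral operators have adjoints\<close>

lemma square_integrable_rep_L2: "square_integrable unit_leb (rep_L2 x)"
  using Quotient_rep_reflp[OF Quotient_L2, of x] by (auto simp: l2_rel_def)

lemma inner_L2_rep: "x \<bullet> y = (LINT s|unit_leb. rep_L2 x s \<bullet> rep_L2 y s)"
  by (simp add: inner_L2_def)

lemma rep_abs_L2:
  assumes "square_integrable unit_leb f"
  shows "AE s in unit_leb. rep_L2 (abs_L2 f) s = f s"
  using Quotient_rep_abs[OF Quotient_L2, of f] assms by (auto simp: l2_rel_def)

lemma norm_matrix_vector_le: "norm (A *v x) \<le> norm A * norm x"
  for A :: "real ^ 'n ^ 'm"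
proof -
  have "norm (A *v x) \<le> L2_set (\<lambda>i. norm (A $ i) * norm x) UNIV"
    unfolding norm_vec_def[of "A *v x"]
    by (rule L2_set_mono) (auto simp: matrix_vector_mul_component Cauchy_Schwarz_ineq2)
  also have "\<dots> = norm A * norm x"
    by (simp add: norm_vec_def[of A] L2_set_left_distrib)
  finally show ?thesis .
qed

lemma Cauchy_Schwarz_integral:
  assumes a: "square_integrable M a" and b: "square_integrable M b"
  shows "(LINT s|M. norm (a s) * norm (b s))\<^sup>2
    \<le> (LINT s|M. (norm (a s))\<^sup>2) * (LINT s|M. (norm (b s))\<^sup>2)"
proof -
  define A where "A = (LINT s|M. (norm (a s))\<^sup>2)"
  define B where "B = (LINT s|M. norm (a s) * norm (b s))"
  define C where "C = (LINT s|M. (norm (b s))\<^sup>2)"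
  have iA: "integrable M (\<lambda>s. (norm (a s))\<^sup>2)" and iC: "integrable M (\<lambda>s. (norm (b s))\<^sup>2)"
    using a b by (auto simp: square_integrable_def)
  note iB = integrable_norm_mult[OF a b]
  have q: "0 \<le> A - 2 * t * B + t\<^sup>2 * C" for t
  proof -
    have "0 \<le> (LINT s|M. (norm (a s) - t * norm (b s))\<^sup>2)"
      by (rule integral_nonneg_AE) simp
    also have "\<dots> = (LINT s|M. (norm (a s))\<^sup>2 - 2 * t * (norm (a s) * norm (b s))
        + t\<^sup>2 * (norm (b s))\<^sup>2)"
      by (intro Bochner_Integration.integral_cong) (auto simp: power2_eq_square algebra_simps)
    also have "\<dots> = A - 2 * t * B + t\<^sup>2 * C"
      using iA iB iC by (simp add: A_def B_def C_def)
    finally show ?thesis .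
  qed
  have A0: "A \<ge> 0" and C0: "C \<ge> 0"
    by (auto simp: A_def C_def intro!: integral_nonneg_AE)
  have "B\<^sup>2 \<le> A * C"
  proof (cases "C = 0")
    case True
    have "B = 0"
    proof (rule ccontr)
      assume "B \<noteq> 0"
      then show False using q[of "(A + 1) / (2 * B)"] True by simp
    qed
    then show ?thesis using True by simp
  next
    case False
    then have "C > 0" using C0 by simp
    have "0 \<le> (A - 2 * (B / C) * B + (B / C)\<^sup>2 * C) * C"
      using q[of "B / C"] C0 by simp
    also have "\<dots> = A * C - B\<^sup>2"
      using \<open>C > 0\<close> by (simp add: power2_eq_square field_simps)
    finally show ?thesis by simp
  qed
  then show ?thesis by (simp add: A_def B_def C_def)
qed

interpretation unit_leb: finite_measure unit_leb
  by (rule finite_measure_lebesgue_on) simp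

interpretation unit_leb2: pair_sigma_finite unit_leb unit_leb ..

lemma measurable_matrix_vector [measurable]:
  fixes f :: "'a \<Rightarrow> real ^ 'n::finite ^ 'm::finite"
  assumes [measurable]: "f \<in> borel_measurable M" "g \<in> borel_measurable M"
  shows "(\<lambda>x. f x *v g x) \<in> borel_measurable M"
proof -
  have "continuous_on UNIV (\<lambda>p::(real^'n^'m) \<times> (real^'n). fst p *v snd p)"
    unfolding matrix_vector_mult_def by (intro continuous_intros)
  from borel_measurable_continuous_onI[OF this]
  have [measurable]: "(\<lambda>p::(real^'n^'m) \<times> (real^'n). fst p *v snd p) \<in> borel_measurable borel" .
  have "(\<lambda>x. (f x, g x)) \<in> borel_measurable M" by measurable
  from measurable_compose[OF this, of "\<lambda>p. fst p *v snd p" borel] show ?thesis by simp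
qed

context
  fixes K :: "real \<times> real \<Rightarrow> real ^ 'm::finite ^ 'm" and f g :: "real \<Rightarrow> real ^ 'm"
  assumes K: "square_integrable (unit_leb \<Otimes>\<^sub>M unit_leb) K"
    and f: "square_integrable unit_leb f" and g: "square_integrable unit_leb g"
begin

lemma kernel_measurable:
  "K \<in> borel_measurable (unit_leb \<Otimes>\<^sub>M unit_leb)"
  "f \<in> borel_measurable unit_leb" "g \<in> borel_measurable unit_leb"
  using K f g by (auto simp: square_integrable_def)

lemma kernel_slice:
  "AE s in unit_leb. square_integrable unit_leb (\<lambda>\<theta>. K (s, \<theta>))"
proof -
  note [measurable] = kernel_measurable
  have "AE s in unit_leb. integrable unit_leb (\<lambda>\<theta>. (norm (K (s, \<theta>)))\<^sup>2)"
    using K by (intro unit_leb2.AE_integrable_fst') (auto simp: square_integrable_def)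
  moreover have "AE s in unit_leb. s \<in> space unit_leb" by (rule AE_space)
  ultimately show ?thesis
    by eventually_elim (auto simp: square_integrable_def)
qed

lemma kernel_integrable:
  "AE s in unit_leb. integrable unit_leb (\<lambda>\<theta>. K (s, \<theta>) *v f \<theta>)"
proof -
  note [measurable] = kernel_measurable
  show ?thesis
  using kernel_slice AE_space[of unit_leb]
proof eventually_elim
  case (elim s)
  then have [measurable]: "(\<lambda>\<theta>. K (s, \<theta>)) \<in> borel_measurable unit_leb"
    by (simp add: square_integrable_def)
  show ?case
    by (rule Bochner_Integration.integrable_bound[OF integrable_norm_mult[OF elim(1) f]])
       (auto intro: norm_matrix_vector_le)
qed
qed

lemma kernel_square_integrable:
  "square_integrable unit_leb (\<lambda>s. LINT \<theta>|unit_leb. K (s, \<theta>) *v f \<theta>)"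
proof -
  note [measurable] = kernel_measurable
  have m [measurable]: "(\<lambda>s. LINT \<theta>|unit_leb. K (s, \<theta>) *v f \<theta>) \<in> borel_measurable unit_leb"
    by measurable
  have "integrable unit_leb (\<lambda>s. LINT \<theta>|unit_leb. (norm (K (s, \<theta>)))\<^sup>2)"
    using K by (intro unit_leb2.integrable_fst') (auto simp: square_integrable_def)
  then have i: "integrable unit_leb (\<lambda>s. (LINT \<theta>|unit_leb. (norm (K (s, \<theta>)))\<^sup>2) *
      (LINT \<theta>|unit_leb. (norm (f \<theta>))\<^sup>2))"
    by simp
  have "AE s in unit_leb. norm ((norm (LINT \<theta>|unit_leb. K (s, \<theta>) *v f \<theta>))\<^sup>2)
    \<le> norm ((LINT \<theta>|unit_leb. (norm (K (s, \<theta>)))\<^sup>2) * (LINT \<theta>|unit_leb. (norm (f \<theta>))\<^sup>2))"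
    using kernel_slice kernel_integrable
  proof eventually_elim
    case (elim s)
    have "norm (LINT \<theta>|unit_leb. K (s, \<theta>) *v f \<theta>) \<le> (LINT \<theta>|unit_leb. norm (K (s, \<theta>) *v f \<theta>))"
      by simp
    also have "\<dots> \<le> (LINT \<theta>|unit_leb. norm (K (s, \<theta>)) * norm (f \<theta>))"
      using elim f by (intro integral_mono integrable_norm_mult) (auto intro: norm_matrix_vector_le)
    finally have "(norm (LINT \<theta>|unit_leb. K (s, \<theta>) *v f \<theta>))\<^sup>2
        \<le> (LINT \<theta>|unit_leb. norm (K (s, \<theta>)) * norm (f \<theta>))\<^sup>2"
      by (simp add: power_mono)
    also have "\<dots> \<le> (LINT \<theta>|unit_leb. (norm (K (s, \<theta>)))\<^sup>2) * (LINT \<theta>|unit_leb. (norm (f \<theta>))\<^sup>2)"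
      by (rule Cauchy_Schwarz_integral[OF elim(1) f])
    finally show ?case by simp
  qed
  then have "integrable unit_leb (\<lambda>s. (norm (LINT \<theta>|unit_leb. K (s, \<theta>) *v f \<theta>))\<^sup>2)"
    by (intro Bochner_Integration.integrable_bound[OF i]) auto
  then show ?thesis by (simp add: square_integrable_def m)
qed

lemma kernel_product_integrable:
  "integrable (unit_leb \<Otimes>\<^sub>M unit_leb) (\<lambda>(s, \<theta>). (K (s, \<theta>) *v f \<theta>) \<bullet> g s)"
proof -
  note [measurable] = kernel_measurable
  have "integrable (unit_leb \<Otimes>\<^sub>M unit_leb) (\<lambda>(s, \<theta>). (norm (f \<theta>))\<^sup>2 * (norm (g s))\<^sup>2)"
  proof (rule unit_leb2.Fubini_integrable)
    show "AE s in unit_leb. integrable unit_leb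
        (\<lambda>\<theta>. case (s, \<theta>) of (s, \<theta>) \<Rightarrow> (norm (f \<theta>))\<^sup>2 * (norm (g s))\<^sup>2)"
      using f by (auto simp: square_integrable_def)
    show "integrable unit_leb (\<lambda>s. LINT \<theta>|unit_leb. norm (case (s, \<theta>) of (s, \<theta>) \<Rightarrow>
        (norm (f \<theta>))\<^sup>2 * (norm (g s))\<^sup>2))"
      using g by (auto simp: square_integrable_def abs_mult)
  qed measurable
  then have i: "integrable (unit_leb \<Otimes>\<^sub>M unit_leb) (\<lambda>p. (norm (K p))\<^sup>2
      + (norm (f (snd p)))\<^sup>2 * (norm (g (fst p)))\<^sup>2)"
    using K by (auto simp: square_integrable_def case_prod_unfold)
  have b: "\<bar>(A *v u) \<bullet> v\<bar> \<le> (norm A)\<^sup>2 + (norm u)\<^sup>2 * (norm v)\<^sup>2"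
    for A :: "real ^ 'm ^ 'm" and u v
  proof -
    have "\<bar>(A *v u) \<bullet> v\<bar> \<le> norm (A *v u) * norm v" by (rule Cauchy_Schwarz_ineq2)
    also have "\<dots> \<le> (norm A * norm u) * norm v"
      by (intro mult_right_mono norm_matrix_vector_le) simp
    also have "\<dots> \<le> (norm A)\<^sup>2 + (norm u * norm v)\<^sup>2"
      using norm_mult_le_squares[of A "norm u * norm v"] by (simp add: mult.assoc abs_mult)
    finally show ?thesis by (simp add: power_mult_distrib)
  qed
  show ?thesis
  proof (rule Bochner_Integration.integrable_bound[OF i])
    have "\<bar>(K p *v f (snd p)) \<bullet> g (fst p)\<bar>
      \<le> \<bar>(norm (K p))\<^sup>2 + (norm (f (snd p)))\<^sup>2 * (norm (g (fst p)))\<^sup>2\<bar>" for p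
      using b[of "K p" "f (snd p)" "g (fst p)"] by linarith
    then show "AE p in unit_leb \<Otimes>\<^sub>M unit_leb. norm (case p of (s, \<theta>) \<Rightarrow> (K (s, \<theta>) *v f \<theta>) \<bullet> g s)
        \<le> norm ((norm (K p))\<^sup>2 + (norm (f (snd p)))\<^sup>2 * (norm (g (fst p)))\<^sup>2)"
      by (simp add: case_prod_unfold)
  qed measurable
qed

end

lemma measurable_transpose [measurable]:
  fixes f :: "'a \<Rightarrow> real ^ 'n::finite ^ 'm::finite"
  assumes f: "f \<in> borel_measurable M"
  shows "(\<lambda>x. transpose (f x)) \<in> borel_measurable M"
proof -
  have "continuous_on UNIV (transpose :: real ^ 'n ^ 'm \<Rightarrow> _)"
    unfolding transpose_def by (intro continuous_intros)
  from measurable_compose[OF f borel_measurable_continuous_onI[OF this]] show ?thesis .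
qed

lemma norm_transpose: "norm (transpose A) = norm A" for A :: "real ^ 'n ^ 'm"
  unfolding norm_eq_sqrt_inner inner_vec_def transpose_def vec_lambda_beta
  by (subst sum.swap) (rule refl)

lemma square_integrable_swap:
  fixes K :: "real \<times> real \<Rightarrow> real ^ 'm::finite ^ 'm"
  assumes K: "square_integrable (unit_leb \<Otimes>\<^sub>M unit_leb) K"
  shows "square_integrable (unit_leb \<Otimes>\<^sub>M unit_leb) (\<lambda>(s, \<theta>). transpose (K (\<theta>, s)))"
proof -
  have [measurable]: "K \<in> borel_measurable (unit_leb \<Otimes>\<^sub>M unit_leb)"
    using K by (simp add: square_integrable_def)
  have i: "integrable (unit_leb \<Otimes>\<^sub>M unit_leb) (\<lambda>(s, \<theta>). (norm (K (\<theta>, s)))\<^sup>2)"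
    using K by (intro unit_leb2.integrable_product_swap) (simp add: square_integrable_def)
  have m: "(\<lambda>(s, \<theta>). transpose (K (\<theta>, s))) \<in> borel_measurable (unit_leb \<Otimes>\<^sub>M unit_leb)"
    by measurable
  show ?thesis
    using i m by (simp add: square_integrable_def norm_transpose case_prod_unfold)
qed

lemma kernel_adjoint:
  fixes K :: "real \<times> real \<Rightarrow> real ^ 'm::finite ^ 'm"
  assumes K: "square_integrable (unit_leb \<Otimes>\<^sub>M unit_leb) K"
    and f: "square_integrable unit_leb f" and g: "square_integrable unit_leb g"
  shows "(LINT s|unit_leb. (LINT \<theta>|unit_leb. K (s, \<theta>) *v f \<theta>) \<bullet> g s)
    = (LINT \<theta>|unit_leb. f \<theta> \<bullet> (LINT s|unit_leb. transpose (K (s, \<theta>)) *v g s))"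
proof -
  have m: "square_integrable (unit_leb \<Otimes>\<^sub>M unit_leb) (\<lambda>(s, \<theta>). transpose (K (\<theta>, s)))"
    by (rule square_integrable_swap[OF K])
  have tr: "(A *v u) \<bullet> v = u \<bullet> (transpose A *v v)" for A :: "real ^ 'm ^ 'm" and u v
    by (metis dot_lmul_matrix inner_commute vector_transpose_matrix transpose_transpose)
  have J1: "AE s in unit_leb. (LINT \<theta>|unit_leb. K (s, \<theta>) *v f \<theta>) \<bullet> g s
      = (LINT \<theta>|unit_leb. (K (s, \<theta>) *v f \<theta>) \<bullet> g s)"
    using kernel_integrable[OF K f g] by eventually_elim simp
  have J2: "AE \<theta> in unit_leb. f \<theta> \<bullet> (LINT s|unit_leb. transpose (K (s, \<theta>)) *v g s)
      = (LINT s|unit_leb. (K (s, \<theta>) *v f \<theta>) \<bullet> g s)"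
    using kernel_integrable[OF m g f] by eventually_elim (simp add: tr)
  note [measurable] = kernel_measurable[OF K f g]
  have "(LINT s|unit_leb. (LINT \<theta>|unit_leb. K (s, \<theta>) *v f \<theta>) \<bullet> g s)
      = (LINT s|unit_leb. LINT \<theta>|unit_leb. (K (s, \<theta>) *v f \<theta>) \<bullet> g s)"
    by (rule integral_cong_AE[OF _ _ J1]) measurable
  also have "\<dots> = (LINT \<theta>|unit_leb. LINT s|unit_leb. (K (s, \<theta>) *v f \<theta>) \<bullet> g s)"
    using unit_leb2.Fubini_integral[OF kernel_product_integrable[OF K f g]] by simp
  also have "\<dots> = (LINT \<theta>|unit_leb. f \<theta> \<bullet> (LINT s|unit_leb. transpose (K (s, \<theta>)) *v g s))"
    by (rule integral_cong_AE[OF _ _ J2, symmetric]) measurable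
  finally show ?thesis .
qed

lemma square_integrable_cut:
  fixes K :: "real \<times> real \<Rightarrow> real ^ 'm::finite ^ 'm"
  assumes K: "square_integrable M K" and [measurable]: "Measurable.pred M p"
  shows "square_integrable M (\<lambda>z. if p z then K z else 0)"
proof -
  have [measurable]: "K \<in> borel_measurable M"
    using K by (simp add: square_integrable_def)
  have i: "integrable M (\<lambda>z. (norm (K z))\<^sup>2)"
    using K by (simp add: square_integrable_def)
  have "integrable M (\<lambda>z. (norm (if p z then K z else 0))\<^sup>2)"
    by (rule Bochner_Integration.integrable_bound[OF i]) auto
  then show ?thesis by (simp add: square_integrable_def)
qed

lemma square_integrable_matrix_mult:
  fixes R :: "real \<Rightarrow> real ^ 'm::finite ^ 'm"
  assumes R: "essentially_bounded M R" and f: "square_integrable M f"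
  shows "square_integrable M (\<lambda>s. R s *v f s)"
proof -
  have [measurable]: "R \<in> borel_measurable M" "f \<in> borel_measurable M"
    using R f by (auto simp: square_integrable_def essentially_bounded_def)
  obtain B where B: "AE s in M. norm (R s) \<le> B"
    using R by (auto simp: essentially_bounded_def)
  have i: "integrable M (\<lambda>s. B\<^sup>2 * (norm (f s))\<^sup>2)"
    using f by (simp add: square_integrable_def)
  have "AE s in M. norm ((norm (R s *v f s))\<^sup>2) \<le> norm (B\<^sup>2 * (norm (f s))\<^sup>2)"
    using B
  proof eventually_elim
    case (elim s)
    have "norm (R s *v f s) \<le> B * norm (f s)"
      using norm_matrix_vector_le[of "R s" "f s"] elim mult_right_mono[OF elim, of "norm (f s)"]
      by simp
    then have "(norm (R s *v f s))\<^sup>2 \<le> (B * norm (f s))\<^sup>2"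
      by (simp add: power_mono)
    then show ?case by (simp add: power_mult_distrib)
  qed
  then have "integrable M (\<lambda>s. (norm (R s *v f s))\<^sup>2)"
    by (intro Bochner_Integration.integrable_bound[OF i]) auto
  then show ?thesis by (simp add: square_integrable_def)
qed

lemma inner_matrix_transpose: "(A *v u) \<bullet> v = u \<bullet> (transpose A *v v)" for A :: "real ^ 'm ^ 'm"
  by (metis dot_lmul_matrix inner_commute vector_transpose_matrix transpose_transpose)

lemma PI_adjoint_exists:
  fixes P :: "'m::finite L2 \<Rightarrow>\<^sub>L 'm L2"
  assumes "P \<in> \<Pi>\<^sub>3"
  shows "\<exists>G. \<forall>x y. P x \<bullet> y = x \<bullet> G y"
proof -
  obtain R0 R1 R2 where R0: "essentially_bounded unit_leb R0"
    and R1: "square_integrable (unit_leb \<Otimes>\<^sub>M unit_leb) R1"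
    and R2: "square_integrable (unit_leb \<Otimes>\<^sub>M unit_leb) R2"
    and P: "has_PI_form P R0 R1 R2"
    using assms by (auto simp: PI_ops_def)
  define K1 where "K1 = (\<lambda>z. if snd z \<le> fst z then R1 z else 0)"
  define K2 where "K2 = (\<lambda>z. if fst z \<le> snd z then R2 z else 0)"
  have [measurable]: "fst \<in> borel_measurable (unit_leb \<Otimes>\<^sub>M unit_leb)"
    "snd \<in> borel_measurable (unit_leb \<Otimes>\<^sub>M unit_leb)"
    by (rule measurable_compose[OF measurable_fst], simp add: measurable_restrict_space1 measurable_completion)
       (rule measurable_compose[OF measurable_snd], simp add: measurable_restrict_space1 measurable_completion)
  have K1: "square_integrable (unit_leb \<Otimes>\<^sub>M unit_leb) K1"
    unfolding K1_def by (rule square_integrable_cut[OF R1]) measurable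
  have K2: "square_integrable (unit_leb \<Otimes>\<^sub>M unit_leb) K2"
    unfolding K2_def by (rule square_integrable_cut[OF R2]) measurable
  define J where "J K f s = (LINT \<theta>|unit_leb. K (s, \<theta>) *v f \<theta>)"
    for K :: "real \<times> real \<Rightarrow> real ^ 'm ^ 'm" and f s
  define tr where "tr K = (\<lambda>(s, \<theta>). transpose (K (\<theta>, s)))"
    for K :: "real \<times> real \<Rightarrow> real ^ 'm ^ 'm"
  have J: "square_integrable unit_leb (J K f)"
    if "square_integrable (unit_leb \<Otimes>\<^sub>M unit_leb) K" "square_integrable unit_leb f" for K f
    unfolding J_def by (rule kernel_square_integrable[OF that that(2)])
  have trs: "square_integrable (unit_leb \<Otimes>\<^sub>M unit_leb) (tr K)"
    if "square_integrable (unit_leb \<Otimes>\<^sub>M unit_leb) K" for K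
    unfolding tr_def by (rule square_integrable_swap[OF that])
  have JJ: "(LINT s|unit_leb. J K f s \<bullet> g s) = (LINT s|unit_leb. f s \<bullet> J (tr K) g s)"
    if "square_integrable (unit_leb \<Otimes>\<^sub>M unit_leb) K" "square_integrable unit_leb f"
      "square_integrable unit_leb g" for K f g
    using kernel_adjoint[OF that] by (simp add: J_def tr_def)
  have R0t: "essentially_bounded unit_leb (\<lambda>s. transpose (R0 s))"
    using R0 by (auto simp: essentially_bounded_def norm_transpose)
  have form: "AE s in unit_leb. rep_L2 (P x) s
      = R0 s *v rep_L2 x s + J K1 (rep_L2 x) s + J K2 (rep_L2 x) s" for x
  proof -
    have "AE s in unit_leb. rep_L2 (P x) s =
        R0 s *v rep_L2 x s
        + (LINT \<theta>|lebesgue_on {0..s}. R1 (s, \<theta>) *v rep_L2 x \<theta>)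
        + (LINT \<theta>|lebesgue_on {s..1}. R2 (s, \<theta>) *v rep_L2 x \<theta>)"
      using P by (simp add: has_PI_form_def)
    then show ?thesis
      using AE_space[of unit_leb]
    proof eventually_elim
      case (elim s)
      then have s: "0 \<le> s" "s \<le> 1" by auto
      have "(LINT \<theta>|lebesgue_on {0..s}. R1 (s, \<theta>) *v rep_L2 x \<theta>) = J K1 (rep_L2 x) s"
        unfolding J_def K1_def using s
        by (subst (1 2) integral_restrict_space)
           (auto intro!: Bochner_Integration.integral_cong simp: indicator_def)
      moreover have "(LINT \<theta>|lebesgue_on {s..1}. R2 (s, \<theta>) *v rep_L2 x \<theta>) = J K2 (rep_L2 x) s"
        unfolding J_def K2_def using s
        by (subst (1 2) integral_restrict_space)
           (auto intro!: Bochner_Integration.integral_cong simp: indicator_def)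
      ultimately show ?case using elim by simp
    qed
  qed
  define h where "h y s = transpose (R0 s) *v rep_L2 y s + J (tr K1) (rep_L2 y) s
      + J (tr K2) (rep_L2 y) s" for y s
  note sq = square_integrable_rep_L2
  have h: "square_integrable unit_leb (h y)" for y
    unfolding h_def
    by (intro square_integrable_add square_integrable_matrix_mult[OF R0t] J trs K1 K2 sq)
  have "P x \<bullet> y = x \<bullet> abs_L2 (h y)" for x y
  proof -
    note s1 = square_integrable_matrix_mult[OF R0 sq[of x]] J[OF K1 sq[of x]] J[OF K2 sq[of x]]
    note s2 = square_integrable_matrix_mult[OF R0t sq[of y]] J[OF trs[OF K1] sq[of y]]
      J[OF trs[OF K2] sq[of y]]
    note [measurable] = sq[THEN square_integrable_measurable] h[THEN square_integrable_measurable]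
      s1[THEN square_integrable_measurable] s2[THEN square_integrable_measurable]
    have "P x \<bullet> y = (LINT s|unit_leb. (R0 s *v rep_L2 x s + J K1 (rep_L2 x) s + J K2 (rep_L2 x) s)
        \<bullet> rep_L2 y s)"
      unfolding inner_L2_rep by (intro integral_cong_AE) (use form[of x] in \<open>auto elim: eventually_mono\<close>)
    also have "\<dots> = (LINT s|unit_leb. (R0 s *v rep_L2 x s) \<bullet> rep_L2 y s)
        + (LINT s|unit_leb. J K1 (rep_L2 x) s \<bullet> rep_L2 y s)
        + (LINT s|unit_leb. J K2 (rep_L2 x) s \<bullet> rep_L2 y s)"
      using s1[THEN integrable_inner, OF sq[of y]] by (simp add: inner_add_left)
    also have "\<dots> = (LINT s|unit_leb. rep_L2 x s \<bullet> (transpose (R0 s) *v rep_L2 y s))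
        + (LINT s|unit_leb. rep_L2 x s \<bullet> J (tr K1) (rep_L2 y) s)
        + (LINT s|unit_leb. rep_L2 x s \<bullet> J (tr K2) (rep_L2 y) s)"
      by (simp add: JJ K1 K2 sq inner_matrix_transpose)
    also have "\<dots> = (LINT s|unit_leb. rep_L2 x s \<bullet> h y s)"
      using s2[THEN integrable_inner[OF sq[of x]]] by (simp add: h_def inner_add_right)
    also have "\<dots> = x \<bullet> abs_L2 (h y)"
      unfolding inner_L2_rep
      by (intro integral_cong_AE) (use rep_abs_L2[OF h[of y]] in \<open>auto elim: eventually_mono\<close>)
    finally show ?thesis .
  qed
  then show ?thesis by (intro exI[of _ "\<lambda>y. abs_L2 (h y)"]) simp
qed

lemma inner_adj:
  fixes P :: "'m::finite L2 \<Rightarrow>\<^sub>L 'm L2"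
  assumes "\<exists>G. \<forall>x y. P x \<bullet> y = x \<bullet> G y"
  shows "x \<bullet> adj P y = P x \<bullet> y"
proof -
  define G where "G = adjoint (blinfun_apply P)"
  have G: "P x \<bullet> y = x \<bullet> G y" for x y
    using assms adjoint_unique[of "blinfun_apply P"] by (metis G_def)
  have ext: "u = v" if "\<And>x. x \<bullet> u = x \<bullet> v" for u v :: "'m L2"
    using that by (metis vector_eq_ldot)
  have "bounded_linear G"
  proof (rule bounded_linear_intro)
    show "G (u + v) = G u + G v" for u v
      by (rule ext) (simp add: inner_add_right flip: G)
    show "G (c *\<^sub>R u) = c *\<^sub>R G u" for c u
      by (rule ext) (simp flip: G)
    show "norm (G y) \<le> norm y * norm P" for y
    proof (cases "G y = 0")
      case False
      have "norm (G y) * norm (G y) = P (G y) \<bullet> y"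
        by (simp add: G flip: power2_norm_eq_inner power2_eq_square)
      also have "\<dots> \<le> norm (P (G y)) * norm y" by (rule norm_cauchy_schwarz)
      also have "\<dots> \<le> (norm P * norm (G y)) * norm y"
        by (intro mult_right_mono norm_blinfun) simp
      also have "\<dots> = norm (G y) * (norm y * norm P)" by simp
      finally show ?thesis using False by simp
    qed simp
  qed
  then show ?thesis
    by (simp add: adj_def G flip: G_def) (simp add: bounded_linear_Blinfun_apply)
qed

lemma inner_adj_PI: "P \<in> \<Pi>\<^sub>3 \<Longrightarrow> x \<bullet> adj P y = P x \<bullet> y"
  by (intro inner_adj PI_adjoint_exists)

lemma inner_adj_PI_compose:
  assumes "P \<in> \<Pi>\<^sub>3" "Q \<in> \<Pi>\<^sub>3"
  shows "x \<bullet> adj (P o\<^sub>L Q) y = P (Q x) \<bullet> y"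
proof -
  have "(P o\<^sub>L Q) x \<bullet> y = x \<bullet> adj Q (adj P y)" for x y
    using assms by (simp add: inner_adj_PI)
  then show ?thesis using inner_adj[of "P o\<^sub>L Q"] by fastforce
qed

section \<open>Partial integral equations\<close>

text \<open>At \<open>t = 0\<close> the derivative is one-sided; values of \<open>x\<close> at negative times play no role.\<close>

definition PIE_solution :: "('m::finite L2 \<Rightarrow>\<^sub>L 'm L2) \<Rightarrow> ('m L2 \<Rightarrow>\<^sub>L 'm L2) \<Rightarrow> (real \<Rightarrow> 'm L2) \<Rightarrow> bool"
  where "PIE_solution T A x \<longleftrightarrow>
    (\<exists>x'. \<forall>t\<ge>0. (x has_vector_derivative x' t) (at t within {0..}) \<and> T (x' t) = A (x t))"

definition PIE_to_PDE_stable :: "('m::finite L2 \<Rightarrow>\<^sub>L 'm L2) \<Rightarrow> ('m L2 \<Rightarrow>\<^sub>L 'm L2) \<Rightarrow> bool"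
  where "PIE_to_PDE_stable T A \<longleftrightarrow>
    (\<exists>C>0. \<forall>x. PIE_solution T A x \<longrightarrow> (\<forall>t\<ge>0. norm (T (x t)) \<le> C * norm (x 0)))"

definition PIE_stable :: "('m::finite L2 \<Rightarrow>\<^sub>L 'm L2) \<Rightarrow> ('m L2 \<Rightarrow>\<^sub>L 'm L2) \<Rightarrow> bool"
  where "PIE_stable T A \<longleftrightarrow>
    (\<exists>C>0. \<forall>x. PIE_solution T A x \<longrightarrow> (\<forall>t\<ge>0. norm (x t) \<le> C * norm (x 0)))"

definition PDE_stable :: "('m::finite L2 \<Rightarrow>\<^sub>L 'm L2) \<Rightarrow> ('m L2 \<Rightarrow>\<^sub>L 'm L2) \<Rightarrow> bool"
  where "PDE_stable T A \<longleftrightarrow>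
    (\<exists>C>0. \<forall>x. PIE_solution T A x \<longrightarrow> (\<forall>t\<ge>0. norm (T (x t)) \<le> C * norm (T (x 0))))"

definition PDE_to_PIE_stable :: "('m::finite L2 \<Rightarrow>\<^sub>L 'm L2) \<Rightarrow> ('m L2 \<Rightarrow>\<^sub>L 'm L2) \<Rightarrow> bool"
  where "PDE_to_PIE_stable T A \<longleftrightarrow>
    (\<exists>C>0. \<forall>x. PIE_solution T A x \<longrightarrow> (\<forall>t\<ge>0. norm (x t) \<le> C * norm (T (x 0))))"

end

theory Submission
  imports Defs
begin

text \<open>
  Each part is Lyapunov's direct method with a quadratic functional
  \<open>V u = u \<bullet> S u\<close>, where \<open>S\<close> is bounded and symmetric.  Along a solution,
  \<open>d/dt V (x t) = 2 * (x t \<bullet> S (x' t))\<close> by symmetry.  The operator \<open>S\<close> is chosen with a right factor \<open>T\<close>: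
  it is \<open>Q T\<close> in the first, second and fourth parts and \<open>T* P T\<close> in the third.  Hence the unknown
  derivative \<open>x'\<close> enters only through \<open>T x'\<close>, which the equation replaces by \<open>A x\<close>, and
  the derivative of \<open>V\<close> becomes the quadratic form of \<open>Q A + A* Q*\<close>, respectively of
  \<open>T* P A + A* P T\<close>, which is nonpositive by hypothesis.

  So \<open>V\<close> does not increase, and stability follows by bounding \<open>V\<close> from below at time \<open>t\<close> by the
  quantity to be controlled and from above at time \<open>0\<close> by the quantity that controls it
  (lemma \<open>quadratic_lyapunov_bound\<close>).  The lower bounds are the coercivity hypotheses. The
  upper bounds come from boundedness of the operator, except in the fourth part, where
  \<open>V u \<le> C * (norm (T u))\<^sup>2\<close> is assumed.
\<close>

lemma quadratic_form_nonincreasing: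
  fixes S :: "'a::real_inner \<Rightarrow>\<^sub>L 'a"
  assumes deriv: "\<And>s. 0 \<le> s \<Longrightarrow> (x has_vector_derivative x' s) (at s within {0..})"
    and sym: "\<And>u v. u \<bullet> S v = S u \<bullet> v"
    and diss: "\<And>s. 0 \<le> s \<Longrightarrow> x s \<bullet> S (x' s) \<le> 0"
    and t: "0 \<le> t"
  shows "x t \<bullet> S (x t) \<le> x 0 \<bullet> S (x 0)"
proof -
  define V where "V s = x s \<bullet> S (x s)" for s
  have dV: "(V has_real_derivative 2 * (x s \<bullet> S (x' s))) (at s within {0..})" if "0 \<le> s" for s
  proof -
    have "((\<lambda>s. x s \<bullet> S (x s)) has_vector_derivative x s \<bullet> S (x' s) + x' s \<bullet> S (x s))
        (at s within {0..})"
      by (intro bounded_bilinear.has_vector_derivative[OF bounded_bilinear_inner] deriv that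
          bounded_linear.has_vector_derivative[OF blinfun.bounded_linear_right])
    moreover have "x' s \<bullet> S (x s) = x s \<bullet> S (x' s)"
      using sym[of "x' s" "x s"] by (simp add: inner_commute)
    ultimately show ?thesis
      by (simp add: V_def[abs_def] has_real_derivative_iff_has_vector_derivative)
  qed
  have "V t \<le> V 0"
  proof (rule DERIV_nonpos_imp_decreasing_open[OF t])
    show "\<exists>y. (V has_real_derivative y) (at s) \<and> y \<le> 0" if s: "0 < s" "s < t" for s
    proof (intro exI conjI)
      have "at s within {0..} = at s"
        by (rule at_within_interior) (use s in simp)
      then show "(V has_real_derivative 2 * (x s \<bullet> S (x' s))) (at s)"
        using dV[of s] s(1) by simp
      show "2 * (x s \<bullet> S (x' s)) \<le> 0"
        using diss[of s] s(1) by simp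
    qed
    show "continuous_on {0..t} V"
    proof (rule DERIV_continuous_on)
      show "(V has_real_derivative 2 * (x s \<bullet> S (x' s))) (at s within {0..t})" if "s \<in> {0..t}" for s
        by (rule DERIV_subset[OF dV]) (use that in auto)
    qed
  qed
  then show ?thesis by (simp add: V_def)
qed

text \<open>The two measurements \<open>L\<close> and \<open>R\<close> are kept separate because the four stability notions differ
  exactly in whether the state or its image under \<open>T\<close> is measured, later and initially.\<close>

lemma quadratic_lyapunov_bound:
  fixes S :: "'a::real_inner \<Rightarrow>\<^sub>L 'a"
    and L :: "'a \<Rightarrow> 'b::real_normed_vector" and R :: "'a \<Rightarrow> 'c::real_normed_vector"
  assumes deriv: "\<And>s. 0 \<le> s \<Longrightarrow> (x has_vector_derivative x' s) (at s within {0..})"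
    and sym: "\<And>u v. u \<bullet> S v = S u \<bullet> v"
    and diss: "\<And>s. 0 \<le> s \<Longrightarrow> x s \<bullet> S (x' s) \<le> 0"
    and lower: "\<And>u. \<epsilon> * (norm (L u))\<^sup>2 \<le> u \<bullet> S u" and \<epsilon>: "0 < \<epsilon>"
    and upper: "\<And>u. u \<bullet> S u \<le> K * (norm (R u))\<^sup>2"
    and t: "0 \<le> t"
  shows "norm (L (x t)) \<le> sqrt (K / \<epsilon>) * norm (R (x 0))"
proof -
  have "\<epsilon> * (norm (L (x t)))\<^sup>2 \<le> K * (norm (R (x 0)))\<^sup>2"
    using lower[of "x t"] quadratic_form_nonincreasing[OF deriv sym diss t] upper[of "x 0"]
    by linarith
  then have "(norm (L (x t)))\<^sup>2 \<le> K / \<epsilon> * (norm (R (x 0)))\<^sup>2"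
    using \<epsilon> by (simp add: field_simps)
  then have "norm (L (x t)) \<le> sqrt (K / \<epsilon> * (norm (R (x 0)))\<^sup>2)"
    by (rule real_le_rsqrt)
  also have "\<dots> = sqrt (K / \<epsilon>) * norm (R (x 0))"
    by (subst real_sqrt_mult) simp
  finally show ?thesis .
qed

lemma inner_blinfun_self_le: "u \<bullet> S u \<le> norm S * (norm u)\<^sup>2"
  for S :: "'a::real_inner \<Rightarrow>\<^sub>L 'a"
proof -
  have "u \<bullet> S u \<le> norm u * norm (S u)" by (rule norm_cauchy_schwarz)
  also have "\<dots> \<le> norm u * (norm S * norm u)"
    by (intro mult_left_mono norm_blinfun) simp
  finally show ?thesis by (simp add: power2_eq_square mult_ac)
qed

text \<open>Here \<open>S = Q T\<close>.  The parts with a multiplier \<open>Q\<close> share the decay of this functional and differ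
  only in the two bounds on it, which are therefore left as hypotheses.\<close>

lemma PIE_bound_of_left_multiplier:
  fixes T A Q :: "'m::finite L2 \<Rightarrow>\<^sub>L 'm L2"
    and L :: "'m L2 \<Rightarrow> 'b::real_normed_vector" and R :: "'m L2 \<Rightarrow> 'c::real_normed_vector"
  assumes PI: "T \<in> \<Pi>\<^sub>3" "A \<in> \<Pi>\<^sub>3" "Q \<in> \<Pi>\<^sub>3"
    and self: "Q o\<^sub>L T = adj (Q o\<^sub>L T)"
    and diss: "(Q o\<^sub>L A) + (adj A o\<^sub>L adj Q) \<preceq> 0"
    and lower: "\<And>u. \<epsilon> * (norm (L u))\<^sup>2 \<le> u \<bullet> Q (T u)" and \<epsilon>: "0 < \<epsilon>"
    and upper: "\<And>u. u \<bullet> Q (T u) \<le> K * (norm (R u))\<^sup>2"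
    and sol: "PIE_solution T A x" and t: "0 \<le> t"
  shows "norm (L (x t)) \<le> sqrt (K / \<epsilon>) * norm (R (x 0))"
proof -
  obtain x' where deriv: "\<And>s. 0 \<le> s \<Longrightarrow> (x has_vector_derivative x' s) (at s within {0..})"
    and eq: "\<And>s. 0 \<le> s \<Longrightarrow> T (x' s) = A (x s)"
    using sol by (auto simp: PIE_solution_def)
  have sym: "u \<bullet> (Q o\<^sub>L T) v = (Q o\<^sub>L T) u \<bullet> v" for u v
    using inner_adj_PI_compose[OF PI(3,1), of u v, folded self] by simp
  have "u \<bullet> Q (A u) \<le> 0" for u
  proof -
    \<comment> \<open>\<open>Q A\<close> and \<open>A* Q*\<close> have the same quadratic form.\<close>
    have "u \<bullet> adj A (adj Q u) = u \<bullet> Q (A u)"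
      using PI by (simp add: inner_adj_PI inner_commute)
    then show ?thesis
      using diss[unfolded op_le_def, rule_format, of u]
      by (simp add: blinfun.add_left inner_add_right)
  qed
  then have dS: "x s \<bullet> (Q o\<^sub>L T) (x' s) \<le> 0" if "0 \<le> s" for s
    using eq[OF that] by simp
  show ?thesis
  proof (rule quadratic_lyapunov_bound[OF deriv sym dS _ \<epsilon> _ t])
    show "\<epsilon> * (norm (L u))\<^sup>2 \<le> u \<bullet> (Q o\<^sub>L T) u" for u
      using lower[of u] by simp
    show "u \<bullet> (Q o\<^sub>L T) u \<le> K * (norm (R u))\<^sup>2" for u
      using upper[of u] by simp
  qed
qed

text \<open>For \<open>S = T* P T\<close> the functional is \<open>u \<bullet> S u = T u \<bullet> P (T u)\<close>, which depends on \<open>u\<close> only through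
  \<open>T u\<close>.  Coercivity and boundedness of \<open>P\<close>, both applied at \<open>T u\<close>, therefore compare it with
  \<open>(norm (T u))\<^sup>2\<close> on either side, and both measurements are \<open>T\<close>.\<close>

lemma PIE_bound_of_coercive_weight:
  fixes T A P :: "'m::finite L2 \<Rightarrow>\<^sub>L 'm L2"
  assumes PI: "T \<in> \<Pi>\<^sub>3" "A \<in> \<Pi>\<^sub>3" "P \<in> \<Pi>\<^sub>3"
    and self: "P = adj P"
    and diss: "(adj T o\<^sub>L P o\<^sub>L A) + (adj A o\<^sub>L P o\<^sub>L T) \<preceq> 0"
    and lower: "\<epsilon> *\<^sub>R id_blinfun \<preceq> P" and \<epsilon>: "0 < \<epsilon>"
    and sol: "PIE_solution T A x" and t: "0 \<le> t"
  shows "norm (T (x t)) \<le> sqrt (norm P / \<epsilon>) * norm (T (x 0))"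
proof -
  obtain x' where deriv: "\<And>s. 0 \<le> s \<Longrightarrow> (x has_vector_derivative x' s) (at s within {0..})"
    and eq: "\<And>s. 0 \<le> s \<Longrightarrow> T (x' s) = A (x s)"
    using sol by (auto simp: PIE_solution_def)
  define S where "S = adj T o\<^sub>L P o\<^sub>L T"
  have symP: "u \<bullet> P v = P u \<bullet> v" for u v
    by (rule inner_adj_PI[OF PI(3), of u v, folded self])
  have S: "u \<bullet> S v = T u \<bullet> P (T v)" for u v
    using PI by (simp add: S_def inner_adj_PI)
  have sym: "u \<bullet> S v = S u \<bullet> v" for u v
    using symP[of "T u" "T v"] S[of u v] S[of v u] by (simp add: inner_commute)
  have "T u \<bullet> P (A u) \<le> 0" for u
  proof -
    have "u \<bullet> adj A (P (T u)) = T u \<bullet> P (A u)"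
      using PI symP[of "A u" "T u"] by (simp add: inner_adj_PI inner_commute)
    moreover have "u \<bullet> adj T (P (A u)) = T u \<bullet> P (A u)"
      using PI by (simp add: inner_adj_PI)
    ultimately show ?thesis
      using diss[unfolded op_le_def, rule_format, of u]
      by (simp add: blinfun.add_left inner_add_right)
  qed
  then have dS: "x s \<bullet> S (x' s) \<le> 0" if "0 \<le> s" for s
    using eq[OF that] by (simp add: S)
  have low: "\<epsilon> * (norm (T u))\<^sup>2 \<le> u \<bullet> S u" for u
    using lower[unfolded op_le_def, rule_format, of "T u"]
    by (simp add: S blinfun.scaleR_left power2_norm_eq_inner)
  have up: "u \<bullet> S u \<le> norm P * (norm (T u))\<^sup>2" for u
    using inner_blinfun_self_le[of "T u" P] by (simp add: S)
  show ?thesis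
    by (rule quadratic_lyapunov_bound[OF deriv sym dS low \<epsilon> up t])
qed

text \<open>The stability notions ask for a strictly positive constant, whereas the square roots above
  may vanish: in the first part, for instance, \<open>Q T\<close> is zero if \<open>T\<close> is.\<close>

lemma positive_constant_bound:
  assumes "\<And>x t. sol x \<Longrightarrow> 0 \<le> (t::real) \<Longrightarrow> norm (f x t) \<le> c * norm (g x)"
  shows "\<exists>C>0. \<forall>x. sol x \<longrightarrow> (\<forall>t\<ge>0. norm (f x t) \<le> C * norm (g x))"
proof (intro exI[of _ "max c 1"] conjI allI impI)
  fix x and t :: real
  assume "sol x" "0 \<le> t"
  then have "norm (f x t) \<le> c * norm (g x)" by (rule assms)
  also have "\<dots> \<le> max c 1 * norm (g x)" by (intro mult_right_mono) auto
  finally show "norm (f x t) \<le> max c 1 * norm (g x)" .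
qed simp

theorem lemma7:
  fixes T A :: "'m::finite L2 \<Rightarrow>\<^sub>L 'm L2"
  assumes "T \<in> \<Pi>\<^sub>3" and "A \<in> \<Pi>\<^sub>3"
  shows
    "((\<exists>Q\<in>\<Pi>\<^sub>3. \<exists>\<epsilon>>0. Q o\<^sub>L T = adj (Q o\<^sub>L T) \<and> \<epsilon> *\<^sub>R (adj T o\<^sub>L T) \<preceq> Q o\<^sub>L T
        \<and> (Q o\<^sub>L A) + (adj A o\<^sub>L adj Q) \<preceq> 0)
      \<longrightarrow> PIE_to_PDE_stable T A)
   \<and> ((\<exists>Q\<in>\<Pi>\<^sub>3. \<exists>\<epsilon>>0. Q o\<^sub>L T = adj (Q o\<^sub>L T) \<and> \<epsilon> *\<^sub>R id_blinfun \<preceq> Q o\<^sub>L T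
        \<and> (Q o\<^sub>L A) + (adj A o\<^sub>L adj Q) \<preceq> 0)
      \<longrightarrow> PIE_stable T A)
   \<and> ((\<exists>P\<in>\<Pi>\<^sub>3. \<exists>\<epsilon>>0. P = adj P \<and> \<epsilon> *\<^sub>R id_blinfun \<preceq> P
        \<and> (adj T o\<^sub>L P o\<^sub>L A) + (adj A o\<^sub>L P o\<^sub>L T) \<preceq> 0)
      \<longrightarrow> PDE_stable T A)
   \<and> ((\<exists>Q\<in>\<Pi>\<^sub>3. \<exists>\<epsilon>>0. \<exists>C>0. Q o\<^sub>L T = adj (Q o\<^sub>L T) \<and> \<epsilon> *\<^sub>R id_blinfun \<preceq> Q o\<^sub>L T
        \<and> Q o\<^sub>L T \<preceq> C *\<^sub>R (adj T o\<^sub>L T)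
        \<and> (Q o\<^sub>L A) + (adj A o\<^sub>L adj Q) \<preceq> 0)
      \<longrightarrow> PDE_to_PIE_stable T A)"
proof -
  have adjT: "u \<bullet> (adj T o\<^sub>L T) u = (norm (T u))\<^sup>2" for u
    using assms by (simp add: inner_adj_PI power2_norm_eq_inner)
  have QT_le: "u \<bullet> Q (T u) \<le> norm (Q o\<^sub>L T) * (norm u)\<^sup>2" for Q :: "'m L2 \<Rightarrow>\<^sub>L 'm L2" and u
    using inner_blinfun_self_le[of u "Q o\<^sub>L T"] by simp
  note bound = PIE_bound_of_left_multiplier[OF assms]
  have part1: "PIE_to_PDE_stable T A"
    if Q: "Q \<in> \<Pi>\<^sub>3" "0 < \<epsilon>" "Q o\<^sub>L T = adj (Q o\<^sub>L T)" "(Q o\<^sub>L A) + (adj A o\<^sub>L adj Q) \<preceq> 0"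
      and low: "\<epsilon> *\<^sub>R (adj T o\<^sub>L T) \<preceq> Q o\<^sub>L T" for Q \<epsilon>
  proof -
    have "\<epsilon> * (norm (T u))\<^sup>2 \<le> u \<bullet> Q (T u)" for u
      using low[unfolded op_le_def, rule_format, of u] adjT[of u] by (simp add: blinfun.scaleR_left)
    from bound[OF Q(1,3,4) this Q(2) QT_le] show ?thesis
      unfolding PIE_to_PDE_stable_def by (rule positive_constant_bound)
  qed
  have norm_low: "\<epsilon> * (norm u)\<^sup>2 \<le> u \<bullet> Q (T u)"
    if "\<epsilon> *\<^sub>R id_blinfun \<preceq> Q o\<^sub>L T" for Q :: "'m L2 \<Rightarrow>\<^sub>L 'm L2" and \<epsilon> u
    using that[unfolded op_le_def, rule_format, of u]
    by (simp add: blinfun.scaleR_left power2_norm_eq_inner)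
  have part2: "PIE_stable T A"
    if Q: "Q \<in> \<Pi>\<^sub>3" "0 < \<epsilon>" "Q o\<^sub>L T = adj (Q o\<^sub>L T)" "(Q o\<^sub>L A) + (adj A o\<^sub>L adj Q) \<preceq> 0"
      and low: "\<epsilon> *\<^sub>R id_blinfun \<preceq> Q o\<^sub>L T" for Q \<epsilon>
    unfolding PIE_stable_def
    by (rule positive_constant_bound) (rule bound[OF Q(1,3,4) norm_low[OF low] Q(2) QT_le])
  have part3: "PDE_stable T A"
    if P: "P \<in> \<Pi>\<^sub>3" "0 < \<epsilon>" "P = adj P" "\<epsilon> *\<^sub>R id_blinfun \<preceq> P"
      "(adj T o\<^sub>L P o\<^sub>L A) + (adj A o\<^sub>L P o\<^sub>L T) \<preceq> 0" for P \<epsilon>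
    unfolding PDE_stable_def
    by (rule positive_constant_bound) (rule PIE_bound_of_coercive_weight[OF assms P(1,3,5,4,2)])
  have part4: "PDE_to_PIE_stable T A"
    if Q: "Q \<in> \<Pi>\<^sub>3" "0 < \<epsilon>" "Q o\<^sub>L T = adj (Q o\<^sub>L T)" "(Q o\<^sub>L A) + (adj A o\<^sub>L adj Q) \<preceq> 0"
      and low: "\<epsilon> *\<^sub>R id_blinfun \<preceq> Q o\<^sub>L T" and up: "Q o\<^sub>L T \<preceq> C *\<^sub>R (adj T o\<^sub>L T)" for Q \<epsilon> C
  proof -
    have "u \<bullet> Q (T u) \<le> C * (norm (T u))\<^sup>2" for u
      using up[unfolded op_le_def, rule_format, of u] adjT[of u] by (simp add: blinfun.scaleR_left)
    from bound[OF Q(1,3,4) norm_low[OF low] Q(2) this] show ?thesis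
      unfolding PDE_to_PIE_stable_def by (rule positive_constant_bound)
  qed
  show ?thesis
    by (intro conjI impI; elim bexE exE conjE; rule part1 part2 part3 part4; assumption)
qed

end
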